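(* If $X$ is an unbounded proper rCAT(0) space, then the bouquet boundary $\partial_{\mathrm B}X$ is nonempty.
   Context: Notation: $a\vee b$ is the maximum and $a\wedge b$ the minimum of $a,b$. A metric space is proper if all its closed balls are compact. Rough CAT(0) spaces. An $h$-short segment ($h\ge 0$) from $x$ to $y$ in a metric space $(X,d)$ is a path from $x$ to $y$ of length at most $d(x,y)+h$. $X$ is a length space if every pair of points is joined by an $h$-short segment for every $h>0$. An $h$-short triangle with vertices $x_1,x_2,x_3$ consists of $h$-short segments $[x_i,x_j]_h$ joining the three pairs of vertices (its sides). A comparison triangle is a geodesic triangle $\overline T\subset\mathbb{R}^2$ with vertices $\bar x_i$ such that $|\bar x_i-\bar x_j|=d(x_i,x_j)$. For $u\in[x_i,x_j]_h$, a point $\bar u\in\overline T$ is an $h$-comparison point for $u$ if $|\bar x_i-\bar u|\le \mathrm{len}([x_i,u]_h)$ and $|\bar u-\bar x_j|\le\mathrm{len}([u,x_j]_h)$, where $[x_i,u]_h,[u,x_j]_h$ are the two subpaths of $[x_i,x_j]_h$. For $C>0$, a length space $X$ is $C$-rCAT(0) if for every $h$-short triangle with vertices $x,y,z$ and $h\le H(x,y,z):=1/(1\vee d(x,y)\vee d(x,z)\vee d(y,z))$ one has $d(u,v)\le|\bar u-\bar v|+C$ whenever $u,v$ lie on different sides of the triangle and $\bar u,\bar v$ are corresponding $h$-comparison points in a comparison triangle. $X$ is rCAT(0) if it is $C$-rCAT(0) for some $C>0$. Bouquets. A short function is a (not necessarily strictly) decreasing function $D:[0,\infty)\to(0,1]$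 with $D(t)\le 1/t$ for $t>1$ and $|D(s)-D(t)|\le|s-t|$. A segment (path) from $x$ to $y$ is $D$-short if it is $h$-short for $h=D(d(x,y))$. For $c\ge0$ and a short function $D$, a $(c,D)$-bouquet from $o\in X$ is a sequence $\beta=(\beta_n)_{n=1}^\infty$ of unit speed $D$-short segments $\beta_n:[0,L_n]\to X$ such that $\beta_n(0)=o$ for all $n$, $(L_n)$ is monotonically increasing with limit infinity, and $d(\beta_m(t),\beta_n(t))\le c$ for all $m\le n$ and $0\le t\le L_m$. A bouquet is a $(c,D)$-bouquet for some $c,D$ and some initial point. Bouquets $\beta^1,\beta^2$ (with $\beta^i_n:[0,L^i_n]\to X$) are asymptotic if there is $K\ge0$ with $d(\beta^1_m(t),\beta^2_n(t))\le K$ for all $m,n$ and $0\le t\le L^1_m\wedge L^2_n$. The bouquet boundary $\partial_{\mathrm B}X$ is the set of asymptoticity classes of bouquets in $X$. *)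

theory Defs
  imports "HOL-Analysis.Analysis"
begin

text \<open>Metric spaces are subsets \<open>X\<close> of a type of class \<open>metric_space\<close>, with the induced metric.\<close>

definition proper_space :: "'a::metric_space set \<Rightarrow> bool" where
  "proper_space X \<longleftrightarrow> (\<forall>x\<in>X. \<forall>r. compact (X \<inter> cball x r))"

text \<open>Length of \<open>\<gamma>\<close> restricted to \<open>{a..b}\<close>, as the supremum over partitions
  \<open>a = t 0 \<le> \<dots> \<le> t n = b\<close>; only meaningful for \<open>a \<le> b\<close>.\<close>

definition path_length :: "(real \<Rightarrow> 'a::metric_space) \<Rightarrow> real \<Rightarrow> real \<Rightarrow> ereal" where
  "path_length \<gamma> a b =
     (SUP (n, t) \<in> {(n::nat, t::nat \<Rightarrow> real). t 0 = a \<and> t n = b \<and> (\<forall>i<n. t i \<le> t (Suc i))}.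
        ereal (\<Sum>i<n. dist (\<gamma> (t i)) (\<gamma> (t (Suc i)))))"

definition short_segment ::
  "'a::metric_space set \<Rightarrow> real \<Rightarrow> 'a \<Rightarrow> 'a \<Rightarrow> (real \<Rightarrow> 'a) \<Rightarrow> real \<Rightarrow> real \<Rightarrow> bool" where
  "short_segment X h x y \<gamma> a b \<longleftrightarrow>
     a \<le> b \<and> continuous_on {a..b} \<gamma> \<and> \<gamma> ` {a..b} \<subseteq> X \<and> \<gamma> a = x \<and> \<gamma> b = y \<and>
     path_length \<gamma> a b \<le> ereal (dist x y + h)"

definition length_space :: "'a::metric_space set \<Rightarrow> bool" where
  "length_space X \<longleftrightarrow> (\<forall>x\<in>X. \<forall>y\<in>X. \<forall>h>0. \<exists>\<gamma> a b. short_segment X h x y \<gamma> a b)"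

text \<open>Vertices and sides of a triangle are indexed by the three-element type \<open>3\<close>, whose addition
  is modulo 3; side \<open>i\<close> is the path \<open>\<gamma> i\<close> on \<open>{a i..b i}\<close>, joining vertex \<open>i\<close> to vertex \<open>i + 1\<close>.\<close>

definition short_triangle ::
  "'a::metric_space set \<Rightarrow> real \<Rightarrow> (3 \<Rightarrow> 'a) \<Rightarrow> (3 \<Rightarrow> real \<Rightarrow> 'a) \<Rightarrow> (3 \<Rightarrow> real) \<Rightarrow> (3 \<Rightarrow> real) \<Rightarrow> bool"
  where
  "short_triangle X h x \<gamma> a b \<longleftrightarrow>
     (\<forall>i. short_segment X h (x i) (x (i + 1)) (\<gamma> i) (a i) (b i))"

definition comparison_triangle :: "(3 \<Rightarrow> 'a::metric_space) \<Rightarrow> (3 \<Rightarrow> real^2) \<Rightarrow> bool" where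
  "comparison_triangle x x' \<longleftrightarrow> (\<forall>i j. dist (x' i) (x' j) = dist (x i) (x j))"

definition triangle_points :: "(3 \<Rightarrow> real^2) \<Rightarrow> (real^2) set" where
  "triangle_points x' = (\<Union>i. closed_segment (x' i) (x' (i + 1)))"

text \<open>\<open>u'\<close> is a comparison point for the point \<open>\<gamma> i s\<close> of side \<open>i\<close>. As \<open>\<gamma> i\<close> need not be injective,
  the two subpaths are determined by the parameter \<open>s\<close>. The point \<open>u'\<close> may lie on any side of the
  comparison triangle.\<close>

definition comparison_point ::
  "(3 \<Rightarrow> real \<Rightarrow> 'a::metric_space) \<Rightarrow> (3 \<Rightarrow> real) \<Rightarrow> (3 \<Rightarrow> real) \<Rightarrow> (3 \<Rightarrow> real^2) \<Rightarrow>
   3 \<Rightarrow> real \<Rightarrow> real^2 \<Rightarrow> bool" where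
  "comparison_point \<gamma> a b x' i s u' \<longleftrightarrow>
     u' \<in> triangle_points x' \<and>
     ereal (dist (x' i) u') \<le> path_length (\<gamma> i) (a i) s \<and>
     ereal (dist u' (x' (i + 1))) \<le> path_length (\<gamma> i) s (b i)"

definition rCAT0_bound :: "(3 \<Rightarrow> 'a::metric_space) \<Rightarrow> real" where
  "rCAT0_bound x =
     1 / max 1 (max (dist (x 1) (x 2)) (max (dist (x 1) (x 3)) (dist (x 2) (x 3))))"

definition rCAT0_with :: "real \<Rightarrow> 'a::metric_space set \<Rightarrow> bool" where
  "rCAT0_with C X \<longleftrightarrow> length_space X \<and>
     (\<forall>h x \<gamma> a b x' i j s t u' v'.
        0 \<le> h \<longrightarrow> h \<le> rCAT0_bound x \<longrightarrow> short_triangle X h x \<gamma> a b \<longrightarrow>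
        comparison_triangle x x' \<longrightarrow> i \<noteq> j \<longrightarrow> s \<in> {a i..b i} \<longrightarrow> t \<in> {a j..b j} \<longrightarrow>
        comparison_point \<gamma> a b x' i s u' \<longrightarrow> comparison_point \<gamma> a b x' j t v' \<longrightarrow>
        dist (\<gamma> i s) (\<gamma> j t) \<le> dist u' v' + C)"

definition rCAT0 :: "'a::metric_space set \<Rightarrow> bool" where
  "rCAT0 X \<longleftrightarrow> (\<exists>C>0. rCAT0_with C X)"

definition short_function :: "(real \<Rightarrow> real) \<Rightarrow> bool" where
  "short_function D \<longleftrightarrow>
     D ` {0..} \<subseteq> {0<..1} \<and> antimono_on {0..} D \<and> (\<forall>t>1. D t \<le> 1 / t) \<and>
     (\<forall>s\<ge>0. \<forall>t\<ge>0. \<bar>D s - D t\<bar> \<le> \<bar>s - t\<bar>)"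

definition unit_speed :: "(real \<Rightarrow> 'a::metric_space) \<Rightarrow> real \<Rightarrow> real \<Rightarrow> bool" where
  "unit_speed \<gamma> a b \<longleftrightarrow>
     (\<forall>s t. a \<le> s \<longrightarrow> s \<le> t \<longrightarrow> t \<le> b \<longrightarrow> path_length \<gamma> s t = ereal (t - s))"

text \<open>A bouquet is a pair of the sequence \<open>L\<close> of lengths and the sequence \<open>\<beta>\<close> of paths, indexed from
  0 instead of 1. The values of \<open>\<beta> n\<close> outside \<open>{0..L n}\<close> are irrelevant: bouquets that differ only
  there are asymptotic, so they define the same point of the boundary.\<close>

type_synonym 'a bouquet = "(nat \<Rightarrow> real) \<times> (nat \<Rightarrow> real \<Rightarrow> 'a)"

definition is_bouquet_from ::
  "'a::metric_space set \<Rightarrow> real \<Rightarrow> (real \<Rightarrow> real) \<Rightarrow> 'a \<Rightarrow> 'a bouquet \<Rightarrow> bool" where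
  "is_bouquet_from X c D p = (\<lambda>(L, \<beta>).
     p \<in> X \<and>
     (\<forall>n. short_segment X (D (dist p (\<beta> n (L n)))) p (\<beta> n (L n)) (\<beta> n) 0 (L n) \<and>
          unit_speed (\<beta> n) 0 (L n)) \<and>
     incseq L \<and> filterlim L at_top sequentially \<and>
     (\<forall>m n t. m \<le> n \<longrightarrow> 0 \<le> t \<longrightarrow> t \<le> L m \<longrightarrow> dist (\<beta> m t) (\<beta> n t) \<le> c))"

definition bouquets :: "'a::metric_space set \<Rightarrow> 'a bouquet set" where
  "bouquets X = {B. \<exists>c D p. 0 \<le> c \<and> short_function D \<and> is_bouquet_from X c D p B}"

definition asymptotic :: "'a::metric_space bouquet \<Rightarrow> 'a bouquet \<Rightarrow> bool" where
  "asymptotic = (\<lambda>(L1, \<beta>1) (L2, \<beta>2).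
     \<exists>K\<ge>0. \<forall>m n t. 0 \<le> t \<longrightarrow> t \<le> min (L1 m) (L2 n) \<longrightarrow> dist (\<beta>1 m t) (\<beta>2 n t) \<le> K)"

definition bouquet_boundary :: "'a::metric_space set \<Rightarrow> 'a bouquet set set" where
  "bouquet_boundary X =
     bouquets X // {(B1, B2). B1 \<in> bouquets X \<and> B2 \<in> bouquets X \<and> asymptotic B1 B2}"

lemma equiv_asymptotic:
  "equiv (bouquets X) {(B1, B2). B1 \<in> bouquets X \<and> B2 \<in> bouquets X \<and> asymptotic B1 B2}"
proof (rule equivI)
  show "refl_on (bouquets X) {(B1, B2). B1 \<in> bouquets X \<and> B2 \<in> bouquets X \<and> asymptotic B1 B2}"
  proof (rule refl_onI)
    fix B assume B: "B \<in> bouquets X"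
    obtain L \<beta> where [simp]: "B = (L, \<beta>)" by (cases B)
    from B obtain c where c: "c \<ge> 0"
      "\<And>m n t. m \<le> n \<Longrightarrow> 0 \<le> t \<Longrightarrow> t \<le> L m \<Longrightarrow> dist (\<beta> m t) (\<beta> n t) \<le> c"
      by (auto simp: bouquets_def is_bouquet_from_def)
    have "dist (\<beta> m t) (\<beta> n t) \<le> c" if "0 \<le> t" "t \<le> min (L m) (L n)" for m n t
      using c(2)[of m n t] c(2)[of n m t] that by (cases "m \<le> n") (auto simp: dist_commute)
    with B c(1) show "(B, B) \<in> {(B1, B2). B1 \<in> bouquets X \<and> B2 \<in> bouquets X \<and> asymptotic B1 B2}"
      by (auto simp: asymptotic_def)
  qed
next
  show "sym {(B1, B2). B1 \<in> bouquets X \<and> B2 \<in> bouquets X \<and> asymptotic B1 B2}"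
    unfolding sym_def asymptotic_def by (fastforce simp: dist_commute)
next
  show "trans {(B1, B2). B1 \<in> bouquets X \<and> B2 \<in> bouquets X \<and> asymptotic B1 B2}"
  proof (rule transI)
    fix B1 B2 B3 :: "'a bouquet"
    assume "(B1, B2) \<in> {(B1, B2). B1 \<in> bouquets X \<and> B2 \<in> bouquets X \<and> asymptotic B1 B2}"
      and "(B2, B3) \<in> {(B1, B2). B1 \<in> bouquets X \<and> B2 \<in> bouquets X \<and> asymptotic B1 B2}"
    moreover obtain L1 \<beta>1 L2 \<beta>2 L3 \<beta>3
      where [simp]: "B1 = (L1, \<beta>1)" "B2 = (L2, \<beta>2)" "B3 = (L3, \<beta>3)"
      by (metis surj_pair)
    ultimately have B: "(L1, \<beta>1) \<in> bouquets X" "(L2, \<beta>2) \<in> bouquets X" "(L3, \<beta>3) \<in> bouquets X"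
      and "asymptotic (L1, \<beta>1) (L2, \<beta>2)" "asymptotic (L2, \<beta>2) (L3, \<beta>3)"
      by auto
    then obtain K K' where K: "K \<ge> 0" "K' \<ge> 0"
      "\<And>m n t. 0 \<le> t \<Longrightarrow> t \<le> min (L1 m) (L2 n) \<Longrightarrow> dist (\<beta>1 m t) (\<beta>2 n t) \<le> K"
      "\<And>m n t. 0 \<le> t \<Longrightarrow> t \<le> min (L2 m) (L3 n) \<Longrightarrow> dist (\<beta>2 m t) (\<beta>3 n t) \<le> K'"
      by (auto simp: asymptotic_def)
    from B(2) have lim: "filterlim L2 at_top sequentially"
      by (auto simp: bouquets_def is_bouquet_from_def)
    have "dist (\<beta>1 m t) (\<beta>3 n t) \<le> K + K'" if t: "0 \<le> t" "t \<le> min (L1 m) (L3 n)" for m n t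
    proof -
      obtain k where "t \<le> L2 k"
        using lim unfolding filterlim_at_top eventually_sequentially by blast
      then show ?thesis
        using K(3)[of t m k] K(4)[of t k n] t dist_triangle[of "\<beta>1 m t" "\<beta>3 n t" "\<beta>2 k t"] by auto
    qed
    with B K(1,2) show "(B1, B3) \<in> {(B1, B2). B1 \<in> bouquets X \<and> B2 \<in> bouquets X \<and> asymptotic B1 B2}"
      by (auto simp: asymptotic_def intro!: exI[of _ "K + K'"])
  qed
qed auto

end

theory Submission imports Defs "HOL-Real_Asymp.Real_Asymp" begin

text \<open>A proper unbounded length space contains a geodesic ray \<open>g\<close>, and the restrictions of \<open>g\<close>
  to \<open>{0..n}\<close> form a bouquet.
  To obtain \<open>g\<close>, take \<open>h\<close>-short segments from \<open>p\<close> to points farther and farther away, with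
  \<open>h\<close> tending to 0, and let \<open>f n t\<close> be a point of the \<open>n\<close>-th segment at distance \<open>t\<close> from \<open>p\<close>.
  The map \<open>f n\<close> is possibly discontinuous, but isometric up to an error \<open>h\<close>. By properness and
  Tychonoff's theorem the sequence \<open>f\<close> has a pointwise cluster point, which is isometric.\<close>

text \<open>The points \<open>a\<close>, \<open>u\<close>, \<open>v\<close>, \<open>b\<close> form
  one of the partitions in the supremum. Two interior points suffice to compare any two points of a
  short segment.\<close>

lemma path_length_ge_dist3:
  assumes "a \<le> u" "u \<le> v" "v \<le> b"
  shows "ereal (dist (\<gamma> a) (\<gamma> u) + dist (\<gamma> u) (\<gamma> v) + dist (\<gamma> v) (\<gamma> b)) \<le> path_length \<gamma> a b"
proof -
  define t where "t = (\<lambda>i::nat. [a, u, v, b] ! i)"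
  have "(3, t) \<in> {(n, t). t 0 = a \<and> t n = b \<and> (\<forall>i<n. t i \<le> t (Suc i))}"
    using assms by (auto simp: t_def less_Suc_eq numeral_3_eq_3)
  then have "(case (3, t) of (n, t) \<Rightarrow> ereal (\<Sum>i<n. dist (\<gamma> (t i)) (\<gamma> (t (Suc i)))))
      \<le> path_length \<gamma> a b"
    unfolding path_length_def by (rule SUP_upper)
  then show ?thesis
    by (simp add: t_def numeral_3_eq_3)
qed

text \<open>Every partition sum telescopes to the same number.\<close>

lemma path_length_isometric:
  assumes iso: "\<And>s t. a \<le> s \<Longrightarrow> s \<le> t \<Longrightarrow> t \<le> b \<Longrightarrow> dist (g s) (g t) = t - s" and "a \<le> b"
  shows "path_length g a b = ereal (b - a)"
proof -
  let ?P = "{(n, t). t 0 = a \<and> t n = b \<and> (\<forall>i<n. t i \<le> t (Suc i))}"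
  have "(\<Sum>i<n. dist (g (t i)) (g (t (Suc i)))) = b - a"
    if t: "t 0 = a" "t n = b" "\<forall>i<n. t i \<le> t (Suc i)" for n and t :: "nat \<Rightarrow> real"
  proof -
    have mono: "t i \<le> t j" if "i \<le> j" "j \<le> n" for i j
      using that t(3) by (induction j rule: dec_induct) (auto intro: order_trans)
    have "(\<Sum>i<n. dist (g (t i)) (g (t (Suc i)))) = (\<Sum>i<n. t (Suc i) - t i)"
      using mono[of 0] mono[of _ n] t by (intro sum.cong refl iso) auto
    also have "\<dots> = b - a"
      using t by (simp add: sum_lessThan_telescope)
    finally show ?thesis .
  qed
  then have "path_length g a b = (SUP (n, t) \<in> ?P. ereal (b - a))"
    unfolding path_length_def by (intro SUP_cong) auto
  \<comment> \<open>The supremum is that of a constant only if some partition exists; over the empty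
    set it would be minus infinity.\<close>
  moreover have "(1, \<lambda>i. if i = 0 then a else b) \<in> ?P"
    using \<open>a \<le> b\<close> by auto
  then have "?P \<noteq> {}"
    by blast
  ultimately show ?thesis
    by (simp add: case_prod_unfold)
qed

text \<open>The triangle inequality through \<open>x\<close> gives the lower bound on
  \<open>dist (f s) (f t)\<close>. The upper bound holds because the length of the segment exceeds
  \<open>dist x y\<close> by at most \<open>h\<close>.\<close>

lemma short_segment_almost_isometric:
  assumes seg: "short_segment X h x y \<gamma> a b"
  obtains f where "\<And>t. 0 \<le> t \<Longrightarrow> t \<le> dist x y \<Longrightarrow> f t \<in> X \<and> dist x (f t) = t"
    and "\<And>s t. 0 \<le> s \<Longrightarrow> s \<le> t \<Longrightarrow> t \<le> dist x y \<Longrightarrow> \<bar>dist (f s) (f t) - (t - s)\<bar> \<le> h"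
proof -
  have ab: "a \<le> b" and cont: "continuous_on {a..b} \<gamma>" and X: "\<gamma> ` {a..b} \<subseteq> X"
    and ends: "\<gamma> a = x" "\<gamma> b = y" and len: "path_length \<gamma> a b \<le> ereal (dist x y + h)"
    using seg by (auto simp: short_segment_def)
  have "\<exists>u. a \<le> u \<and> u \<le> b \<and> dist x (\<gamma> u) = t" if "0 \<le> t" "t \<le> dist x y" for t
    using that ab ends by (intro IVT' continuous_intros cont) auto
  then obtain u where u: "a \<le> u t" "u t \<le> b" "dist x (\<gamma> (u t)) = t"
    if "0 \<le> t" "t \<le> dist x y" for t
    by metis
  have short: "dist x (\<gamma> v) + dist (\<gamma> v) (\<gamma> w) + dist (\<gamma> w) y \<le> dist x y + h"
    if "a \<le> v" "v \<le> w" "w \<le> b" for v w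
    using order_trans[OF path_length_ge_dist3[OF that] len] ends by simp
  have "\<bar>dist (\<gamma> (u s)) (\<gamma> (u t)) - (t - s)\<bar> \<le> h" if "0 \<le> s" "s \<le> t" "t \<le> dist x y" for s t
  proof -
    \<comment> \<open>Moving forward along the segment costs at most \<open>h\<close> more than what
      is gained in distance from \<open>x\<close>.\<close>
    have *: "dist (\<gamma> v) (\<gamma> w) \<le> dist x (\<gamma> w) - dist x (\<gamma> v) + h" if "a \<le> v" "v \<le> w" "w \<le> b" for v w
      using short[OF that] dist_triangle[of x y "\<gamma> w"] by linarith
    have us: "a \<le> u s" "u s \<le> b" "dist x (\<gamma> (u s)) = s"
      and ut: "a \<le> u t" "u t \<le> b" "dist x (\<gamma> (u t)) = t"
      using u that by auto
    have "0 \<le> h"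
      using *[of a a] ab by simp
    moreover have "t - s \<le> dist (\<gamma> (u s)) (\<gamma> (u t))"
      using us ut dist_triangle[of x "\<gamma> (u t)" "\<gamma> (u s)"] by simp
    \<comment> \<open>The choice of \<open>u\<close> need not be monotone. If
      \<open>u t < u s\<close>, then \<open>*\<close> gives the bound \<open>s - t + h\<close>,
      which is at most \<open>t - s + h\<close>.\<close>
    ultimately show ?thesis
      using *[of "u s" "u t"] *[of "u t" "u s"] us ut \<open>s \<le> t\<close>
      by (cases "u s \<le> u t") (auto simp: dist_commute)
  qed
  moreover have "\<gamma> (u t) \<in> X \<and> dist x (\<gamma> (u t)) = t" if "0 \<le> t" "t \<le> dist x y" for t
    using u[OF that] X by auto
  ultimately show thesis
    by (intro that[of "\<gamma> \<circ> u"]) auto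
qed

lemma geodesic_ray_exists:
  fixes X :: "'a::metric_space set"
  assumes "\<not> bounded X" "proper_space X" "length_space X" and p: "p \<in> X"
  obtains g where "g 0 = p" "\<And>t. g t \<in> X"
    "\<And>s t. 0 \<le> s \<Longrightarrow> s \<le> t \<Longrightarrow> dist (g s) (g t) = t - s"
proof -
  \<comment> \<open>The factor is \<open>{p}\<close> at \<open>t = 0\<close>, which forces
    \<open>g 0 = p\<close>. Adding \<open>p\<close> matters for negative \<open>t\<close>, where the
    ball is empty.\<close>
  define K where "K = PiE UNIV (\<lambda>t. X \<inter> cball p t \<union> {p})"
  have "\<exists>f. f \<in> K \<and> (\<forall>s t. 0 \<le> s \<longrightarrow> s \<le> t \<longrightarrow> t \<le> real n \<longrightarrow>
          \<bar>dist (f s) (f t) - (t - s)\<bar> \<le> 1 / real (Suc n))" for n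
  proof -
    obtain y where y: "y \<in> X" "real n \<le> dist p y"
      using \<open>\<not> bounded X\<close> unfolding bounded_any_center[of X p] by (meson linear)
    then obtain \<gamma> a b where "short_segment X (1 / real (Suc n)) p y \<gamma> a b"
      using \<open>length_space X\<close> p unfolding length_space_def
      by (metis of_nat_0_less_iff zero_less_Suc zero_less_divide_1_iff)
    then obtain f where f: "\<And>t. 0 \<le> t \<Longrightarrow> t \<le> dist p y \<Longrightarrow> f t \<in> X \<and> dist p (f t) = t"
      and iso: "\<And>s t. 0 \<le> s \<Longrightarrow> s \<le> t \<Longrightarrow> t \<le> dist p y \<Longrightarrow>
        \<bar>dist (f s) (f t) - (t - s)\<bar> \<le> 1 / real (Suc n)"
      using short_segment_almost_isometric by blast
    define f' where "f' t = (if 0 \<le> t \<and> t \<le> dist p y then f t else p)" for t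
    show ?thesis
    proof (intro exI[of _ f'] conjI allI impI)
      show "f' \<in> K"
        using f by (auto simp: K_def f'_def)
    next
      fix s t :: real
      assume "0 \<le> s" "s \<le> t" "t \<le> real n"
      then show "\<bar>dist (f' s) (f' t) - (t - s)\<bar> \<le> 1 / real (Suc n)"
        using iso[of s t] y(2) by (simp add: f'_def)
    qed
  qed
  then obtain f where fK: "f n \<in> K"
    and iso: "0 \<le> s \<Longrightarrow> s \<le> t \<Longrightarrow> t \<le> real n \<Longrightarrow>
        \<bar>dist (f n s) (f n t) - (t - s)\<bar> \<le> 1 / real (Suc n)" for n s t
    by metis
  have "compactin (product_topology (\<lambda>_. euclidean) UNIV) K"
    using \<open>proper_space X\<close> p unfolding K_def compactin_PiE proper_space_def by auto
  then have "compact K"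
    by (simp add: euclidean_product_topology)
  \<comment> \<open>An uncountable product of compact spaces need not be sequentially compact, so a
    cluster point of the image filter replaces the limit of a subsequence.\<close>
  moreover have "filtermap f sequentially \<noteq> bot"
    by (simp add: filtermap_bot_iff)
  moreover have "eventually (\<lambda>k. k \<in> K) (filtermap f sequentially)"
    using fK by (simp add: eventually_filtermap)
  ultimately obtain g where g: "g \<in> K"
    and cluster: "inf (nhds g) (filtermap f sequentially) \<noteq> bot"
    unfolding compact_filter by blast
  have "dist (g s) (g t) = t - s" if st: "0 \<le> s" "s \<le> t" for s t
  proof -
    have "\<bar>dist (g s) (g t) - (t - s)\<bar> \<le> e" if "0 < e" for e
    proof (rule ccontr)
      \<comment> \<open>The set \<open>?U\<close> is open because it constrains only the coordinates
        \<open>s\<close> and \<open>t\<close>. It would be a neighbourhood of \<open>g\<close> that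
        \<open>f n\<close> eventually avoids, so \<open>g\<close> could not be a cluster
        point.\<close>
      let ?U = "{k. e < \<bar>dist (k s) (k t) - (t - s)\<bar>}"
      assume "\<not> ?thesis"
      then have "g \<in> ?U"
        by simp
      moreover have "open ?U"
        by (intro open_Collect_less continuous_intros continuous_on_product_coordinates)
      ultimately have U: "eventually (\<lambda>k. k \<in> ?U) (nhds g)"
        by (intro eventually_nhds_in_open)
      have "eventually (\<lambda>n. t \<le> real n) sequentially"
        by real_asymp
      moreover have "eventually (\<lambda>n. 1 / real (Suc n) < e) sequentially"
        using \<open>0 < e\<close> by real_asymp
      ultimately have "eventually (\<lambda>n. f n \<notin> ?U) sequentially"
      proof eventually_elim
        case (elim n)
        then show ?case
          using iso[of s t n] st by simp
      qed
      then have "eventually (\<lambda>k. k \<notin> ?U) (filtermap f sequentially)"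
        by (simp add: eventually_filtermap)
      with U have "eventually (\<lambda>_. False) (inf (nhds g) (filtermap f sequentially))"
        unfolding eventually_inf by blast
      with cluster show False
        by (simp add: trivial_limit_def)
    qed
    then have "\<bar>dist (g s) (g t) - (t - s)\<bar> \<le> 0"
      by (metis field_le_epsilon add_0)
    then show ?thesis
      by simp
  qed
  moreover have gX: "g t \<in> X \<inter> cball p t \<union> {p}" for t
    using g by (auto simp: K_def)
  moreover have "g 0 = p"
    using gX[of 0] by auto
  moreover have "g t \<in> X" for t
    using gX[of t] p by auto
  ultimately show thesis
    using that by blast
qed

text \<open>This is the largest short function. It is 1-Lipschitz because \<open>max 1 t\<close> is,
  and the denominators are at least 1.\<close>

lemma short_function_inverse_max: "short_function (\<lambda>t. 1 / max 1 t)"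
proof -
  have "\<bar>1 / max 1 s - 1 / max 1 t\<bar> \<le> \<bar>s - t\<bar>" for s t :: real
  proof -
    have "1 * 1 \<le> max 1 s * max 1 t"
      by (intro mult_mono) auto
    moreover have "1 / max 1 s - 1 / max 1 t = (max 1 t - max 1 s) / (max 1 s * max 1 t)"
      by (simp add: field_simps)
    ultimately have "\<bar>1 / max 1 s - 1 / max 1 t\<bar> \<le> \<bar>max 1 t - max 1 s\<bar>"
      by (simp add: abs_divide abs_mult divide_le_eq mult_le_cancel_left1)
    also have "\<dots> \<le> \<bar>s - t\<bar>"
      by linarith
    finally show ?thesis .
  qed
  then show ?thesis
    unfolding short_function_def by (auto simp: monotone_on_def intro!: frac_le)
qed

text \<open>All paths are restrictions of the same \<open>g\<close>, so \<open>c = 0\<close> works.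
  Each has length equal to the distance of its endpoints, hence is \<open>D\<close>-short for the
  positive function \<open>?D\<close>.\<close>

lemma geodesic_ray_bouquet:
  assumes X: "\<And>t. 0 \<le> t \<Longrightarrow> g t \<in> X"
    and iso: "\<And>s t. 0 \<le> s \<Longrightarrow> s \<le> t \<Longrightarrow> dist (g s) (g t) = t - s"
  shows "(real, \<lambda>_. g) \<in> bouquets X"
proof -
  let ?D = "\<lambda>t::real. 1 / max 1 t"
  have length: "path_length g s t = ereal (t - s)" if "0 \<le> s" "s \<le> t" for s t
    using that by (intro path_length_isometric iso) auto
  have "dist (g s) (g t) = dist s t" if "0 \<le> s" "0 \<le> t" for s t
    using iso[of s t] iso[of t s] that by (cases "s \<le> t") (auto simp: dist_commute dist_real_def)
  then have "continuous_on {0..} g"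
    unfolding continuous_on_iff by (metis atLeast_iff)
  then have cont: "continuous_on {0..r} g" for r
    by (rule continuous_on_subset) auto
  have "is_bouquet_from X 0 ?D (g 0) (real, \<lambda>_. g)"
    unfolding is_bouquet_from_def short_segment_def unit_speed_def
    using X iso length cont
    by (auto simp: incseq_def filterlim_real_sequentially)
  then show ?thesis
    using short_function_inverse_max unfolding bouquets_def by blast
qed

theorem theorem1p3:
  fixes X :: "'a::metric_space set"
  assumes "\<not> bounded X" and "proper_space X" and "rCAT0 X"
  shows "bouquet_boundary X \<noteq> {}"
proof -
  have "length_space X"
    using assms(3) by (auto simp: rCAT0_def rCAT0_with_def)
  moreover obtain p where "p \<in> X"
    using assms(1) by (metis bounded_empty equals0I)
  ultimately obtain g where "\<And>t. g t \<in> X"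
    "\<And>s t. 0 \<le> s \<Longrightarrow> s \<le> t \<Longrightarrow> dist (g s) (g t) = t - s"
    using geodesic_ray_exists assms by metis
  then have "(real, \<lambda>_. g) \<in> bouquets X"
    by (intro geodesic_ray_bouquet)
  then show ?thesis
    unfolding bouquet_boundary_def by (auto simp: quotient_def)
qed

end
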